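(* For all integers $\ell > k \geq 3$, we have $\pi(K_{\ell}^{(k)}) < \pi(K_{\ell+1}^{(k)})$ and $\pi(K_{\ell}^{(k)-}) < \pi(K_{\ell+1}^{(k)-})$.
   Context: A $k$-uniform hypergraph ($k$-graph) $H=(V,E)$ has vertex set $V$ and edge set $E\subseteq \binom{V}{k}$. For $k$-graphs $F,H$, $H$ is $F$-free if $H$ contains no copy of $F$ (no subhypergraph isomorphic to $F$). The Turán number $\mathrm{ex}(n,F)$ is the maximum number of edges of an $F$-free $k$-graph on $n$ vertices, and the Turán density is $\pi(F)=\lim_{n\to\infty}\mathrm{ex}(n,F)/\binom{n}{k}$ (this limit exists). $K_{\ell}^{(k)}$ denotes the complete $k$-graph on $\ell$ vertices, and $K_{\ell}^{(k)-}$ denotes $K_{\ell}^{(k)}$ with one edge removed. *)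

theory Defs
  imports Complex_Main
begin

text \<open>A hypergraph is a pair of its vertex set and its edge set.\<close>

type_synonym 'a hypergraph = "'a set \<times> 'a set set"

abbreviation verts :: "'a hypergraph \<Rightarrow> 'a set" where
  "verts H \<equiv> fst H"

abbreviation edges :: "'a hypergraph \<Rightarrow> 'a set set" where
  "edges H \<equiv> snd H"

definition uniform_hypergraph :: "nat \<Rightarrow> 'a hypergraph \<Rightarrow> bool" where
  "uniform_hypergraph k H \<longleftrightarrow>
     finite (verts H) \<and> edges H \<subseteq> {e. e \<subseteq> verts H \<and> card e = k}"

text \<open>Subhypergraphs need not be induced.\<close>

definition subhypergraph :: "'a hypergraph \<Rightarrow> 'a hypergraph \<Rightarrow> bool" where
  "subhypergraph S H \<longleftrightarrow>
     verts S \<subseteq> verts H \<and> edges S \<subseteq> edges H \<and> (\<forall>e\<in>edges S. e \<subseteq> verts S)"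

definition hypergraph_iso :: "'a hypergraph \<Rightarrow> 'b hypergraph \<Rightarrow> bool" where
  "hypergraph_iso F S \<longleftrightarrow>
     (\<exists>f. bij_betw f (verts F) (verts S) \<and> edges S = (\<lambda>e. f ` e) ` edges F)"

definition hypergraph_free :: "'b hypergraph \<Rightarrow> 'a hypergraph \<Rightarrow> bool" where
  "hypergraph_free F H \<longleftrightarrow> \<not> (\<exists>S. subhypergraph S H \<and> hypergraph_iso F S)"

text \<open>
  Host hypergraphs are taken on sets of natural numbers; every finite hypergraph is
  isomorphic to one of these. The uniformity \<open>k\<close> is an explicit argument. The maximum is
  over a finite set, which is nonempty if \<open>F\<close> has an edge (the edgeless host is \<open>F\<close>-free).
\<close>

definition turan_number :: "nat \<Rightarrow> nat \<Rightarrow> 'b hypergraph \<Rightarrow> nat" where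
  "turan_number k n F =
     Max {card (edges H) | H :: nat hypergraph.
            uniform_hypergraph k H \<and> card (verts H) = n \<and> hypergraph_free F H}"

definition turan_density :: "nat \<Rightarrow> 'b hypergraph \<Rightarrow> real" where
  "turan_density k F = lim (\<lambda>n. real (turan_number k n F) / real (n choose k))"

definition complete_hypergraph :: "nat \<Rightarrow> nat \<Rightarrow> nat hypergraph" where
  "complete_hypergraph k l = ({..<l}, {e. e \<subseteq> {..<l} \<and> card e = k})"

text \<open>
  Up to isomorphism it does not matter which edge is removed from the complete hypergraph;
  for \<open>k \<le> l\<close> the set \<open>{..<k}\<close> is one of its edges.
\<close>

definition complete_hypergraph_minus :: "nat \<Rightarrow> nat \<Rightarrow> nat hypergraph" where
  "complete_hypergraph_minus k l =
     (verts (complete_hypergraph k l), edges (complete_hypergraph k l) - {{..<k}})"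

end

theory Submission
  imports Defs
begin

text \<open>
  Let \<open>a < 1\<close> be the smaller density. Take an extremal host on a vertex set \<open>A\<close>, add a set \<open>B\<close> of new
  vertices, and add all edges that meet \<open>B\<close> in exactly one vertex. A clique of the new hypergraph with
  \<open>l + 1\<close> vertices and at most one missing edge has at most one vertex in \<open>B\<close> (two of them would give
  \<open>(l - 1) choose (k - 2) \<ge> 2\<close> missing edges), so it leaves such a clique with \<open>l\<close> vertices in \<open>A\<close>. If
  \<open>|B| = x |A|\<close>, the new density tends to \<open>(a + k x) / (1 + x) ^ k\<close>, whose derivative at \<open>0\<close> is
  \<open>k (1 - a) > 0\<close>.
\<close>

section \<open>Turan numbers\<close>

lemma finite_edges:
  assumes "uniform_hypergraph k H"
  shows "finite (edges H)"
  using assms finite_subset[of "edges H" "Pow (verts H)"]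
  unfolding uniform_hypergraph_def by blast

lemma card_edges_le:
  assumes "uniform_hypergraph k H"
  shows "card (edges H) \<le> card (verts H) choose k"
proof -
  have fin: "finite (verts H)" and sub: "edges H \<subseteq> {e. e \<subseteq> verts H \<and> card e = k}"
    using assms unfolding uniform_hypergraph_def by auto
  have "card (edges H) \<le> card {e. e \<subseteq> verts H \<and> card e = k}"
    using sub fin by (intro card_mono) auto
  then show ?thesis
    using n_subsets[OF fin, of k] by simp
qed

lemma hypergraph_free_edgeless:
  assumes "edges F \<noteq> {}" and "edges H = {}"
  shows "hypergraph_free F H"
  using assms unfolding hypergraph_free_def hypergraph_iso_def subhypergraph_def by auto

lemma hypergraph_free_mono:
  assumes "hypergraph_free F H" and "verts H' \<subseteq> verts H" and "edges H' \<subseteq> edges H"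
  shows "hypergraph_free F H'"
  using assms unfolding hypergraph_free_def subhypergraph_def by (meson subset_trans)

text \<open>There may be infinitely many hosts of order \<open>n\<close>, but their edge counts are
  at most \<open>n choose k\<close>.\<close>

lemma finite_turan_set:
  "finite {card (edges H) | H :: nat hypergraph.
     uniform_hypergraph k H \<and> card (verts H) = n \<and> hypergraph_free F H}"
  by (rule finite_subset[of _ "{..n choose k}"]) (use card_edges_le in auto)

lemma card_edges_le_turan_number:
  fixes H :: "nat hypergraph"
  assumes "uniform_hypergraph k H" and "hypergraph_free F H"
  shows "card (edges H) \<le> turan_number k (card (verts H)) F"
  unfolding turan_number_def by (rule Max_ge[OF finite_turan_set]) (use assms in blast)

text \<open>\<open>Max\<close> of the empty set is unspecified; the edgeless host shows that the set
  here is nonempty.\<close>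

lemma turan_number_attained:
  assumes "edges F \<noteq> {}"
  obtains H :: "nat hypergraph"
  where "uniform_hypergraph k H" "card (verts H) = n" "hypergraph_free F H"
    "card (edges H) = turan_number k n F"
proof -
  let ?X = "{card (edges H) | H :: nat hypergraph.
     uniform_hypergraph k H \<and> card (verts H) = n \<and> hypergraph_free F H}"
  have "uniform_hypergraph k ({..<n}, {})" "hypergraph_free F ({..<n}, {} :: nat set set)"
    using assms by (auto simp: uniform_hypergraph_def hypergraph_free_edgeless)
  then have "card (edges ({..<n}, {} :: nat set set)) \<in> ?X"
    by fastforce
  then have "turan_number k n F \<in> ?X"
    unfolding turan_number_def by (intro Max_in[OF finite_turan_set]) blast
  then show thesis
    using that by auto
qed

text \<open>Count the pairs of an edge and a vertex outside it in an extremal host: each edge misses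
  \<open>Suc n - k\<close> vertices, and deleting a vertex leaves an \<open>F\<close>-free host of
  order \<open>n\<close>.\<close>

lemma turan_number_averaging:
  assumes "edges F \<noteq> {}"
  shows "turan_number k (Suc n) F * (Suc n - k) \<le> Suc n * turan_number k n F"
proof -
  obtain H :: "nat hypergraph" where H: "uniform_hypergraph k H" "card (verts H) = Suc n"
    "hypergraph_free F H" "card (edges H) = turan_number k (Suc n) F"
    using turan_number_attained[OF assms] .
  have fin: "finite (verts H)" and edge: "\<And>e. e \<in> edges H \<Longrightarrow> e \<subseteq> verts H \<and> card e = k"
    using H(1) unfolding uniform_hypergraph_def by auto
  have del: "card {e \<in> edges H. v \<notin> e} \<le> turan_number k n F" if "v \<in> verts H" for v
  proof -
    let ?D = "(verts H - {v}, {e \<in> edges H. v \<notin> e})"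
    have "uniform_hypergraph k ?D"
      using fin edge unfolding uniform_hypergraph_def by auto
    moreover have "hypergraph_free F ?D"
      by (rule hypergraph_free_mono[OF H(3)]) auto
    moreover have "card (verts ?D) = n"
      using H(2) fin that by simp
    ultimately show ?thesis
      using card_edges_le_turan_number by fastforce
  qed
  have "turan_number k (Suc n) F * (Suc n - k) = (\<Sum>e\<in>edges H. card {v \<in> verts H. v \<notin> e})"
  proof -
    have "card {v \<in> verts H. v \<notin> e} = Suc n - k" if "e \<in> edges H" for e
    proof -
      have "{v \<in> verts H. v \<notin> e} = verts H - e"
        by auto
      then show ?thesis
        using edge[OF that] H(2) fin by (metis card_Diff_subset finite_subset)
    qed
    then show ?thesis
      using H(4) by simp
  qed
  also have "\<dots> = (\<Sum>v\<in>verts H. card {e \<in> edges H. v \<notin> e})"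
    using sum.swap_restrict[OF fin finite_edges[OF H(1)], of "\<lambda>_ _. 1 :: nat" "\<lambda>v e. v \<notin> e"]
    by simp
  also have "\<dots> \<le> (\<Sum>v\<in>verts H. turan_number k n F)"
    by (rule sum_mono) (rule del)
  finally show ?thesis
    using H(2) by simp
qed

section \<open>Turan densities\<close>

text \<open>The ratios are nonincreasing only from \<open>n = k\<close> on: for \<open>n < k\<close> they are \<open>0 / 0 = 0\<close>.\<close>

lemma turan_ratio_Suc_le:
  assumes "edges F \<noteq> {}" and "k \<le> n"
  shows "real (turan_number k (Suc n) F) / real (Suc n choose k)
    \<le> real (turan_number k n F) / real (n choose k)"
proof -
  let ?s = "real (turan_number k (Suc n) F)" and ?t = "real (turan_number k n F)"
  have avg: "?s * real (Suc n - k) \<le> real (Suc n) * ?t"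
    using turan_number_averaging[OF assms(1), of k n] by (metis of_nat_le_iff of_nat_mult)
  have pos: "0 < real (n choose k)" "0 < real (Suc n choose k)" "0 < real (Suc n - k)"
    using assms(2) by simp_all
  \<comment> \<open>This identity converts the averaging factor into the quotient of the two
    binomial coefficients.\<close>
  have "(Suc n - k) * (Suc n choose k) = Suc n * (n choose k)"
    using binomial_absorb_comp[of "Suc n" k] by simp
  then have absorb: "real (Suc n - k) * real (Suc n choose k) = real (Suc n) * real (n choose k)"
    by (metis of_nat_mult)
  have "real (Suc n - k) * (?s * real (n choose k)) \<le> real (Suc n) * ?t * real (n choose k)"
    using mult_right_mono[OF avg, of "real (n choose k)"] by (simp add: mult_ac)
  also have "\<dots> = real (Suc n - k) * (?t * real (Suc n choose k))"
    using absorb by (metis mult.assoc mult.commute)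
  finally have "?s * real (n choose k) \<le> ?t * real (Suc n choose k)"
    using pos(3) by simp
  then show ?thesis
    using pos by (simp add: divide_simps mult.commute)
qed

text \<open>The ratios are nonnegative and nonincreasing from \<open>k\<close> on, so they converge
  to their infimum. Hence each single ratio bounds the density from above: at order \<open>l\<close>
  this yields a density below 1, at large orders a lower bound for Turan numbers.\<close>

lemma turan_density_limit:
  assumes "edges F \<noteq> {}"
  shows "(\<lambda>n. real (turan_number k n F) / real (n choose k)) \<longlonglongrightarrow> turan_density k F"
    and "k \<le> n \<Longrightarrow> turan_density k F \<le> real (turan_number k n F) / real (n choose k)"
proof -
  let ?d = "\<lambda>n. real (turan_number k n F) / real (n choose k)"
  have dec: "decseq (\<lambda>n. ?d (n + k))"
    using turan_ratio_Suc_le[OF assms] by (intro decseq_SucI) simp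
  then have "convergent (\<lambda>n. ?d (n + k))"
    by (intro Bseq_monoseq_convergent decseq_imp_monoseq) (auto intro: decseq_bounded[of _ 0])
  then have "convergent ?d"
    using convergent_ignore_initial_segment by blast
  then show lim: "?d \<longlonglongrightarrow> turan_density k F"
    unfolding turan_density_def by (simp add: convergent_LIMSEQ_iff)
  show "turan_density k F \<le> ?d n" if "k \<le> n"
    using decseq_ge[OF dec LIMSEQ_ignore_initial_segment[OF lim], of "n - k"] that by simp
qed

section \<open>Growth of binomial coefficients\<close>

text \<open>The quotient is a product of \<open>k\<close> factors \<open>1 - i / n\<close>, each
  tending to 1, divided by \<open>fact k\<close>.\<close>

lemma binomial_over_power_tendsto:
  "(\<lambda>n. real (n choose k) / real n ^ k) \<longlonglongrightarrow> 1 / fact k"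
proof -
  have "(\<lambda>n. (\<Prod>i<k. 1 - real i / real n) / fact k) \<longlonglongrightarrow> (\<Prod>i<k. 1 - 0) / fact k"
    by (intro tendsto_intros lim_const_over_n) auto
  moreover have "eventually (\<lambda>n. (\<Prod>i<k. 1 - real i / real n) / fact k
      = real (n choose k) / real n ^ k) sequentially"
  \<comment> \<open>\<open>n = 0\<close> is left out: division by zero gives 0, so for
    \<open>0 < k\<close> the left side would be \<open>1 / fact k\<close> and the right side
    0.\<close>
  proof (rule eventually_sequentiallyI[of 1])
    fix n :: nat
    assume "1 \<le> n"
    then have "(\<Prod>i<k. 1 - real i / real n) = (\<Prod>i<k. (real n - real i) / real n)"
      by (intro prod.cong) (auto simp: field_simps)
    then show "(\<Prod>i<k. 1 - real i / real n) / fact k = real (n choose k) / real n ^ k"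
      by (simp add: binomial_gbinomial gbinomial_prod_rev prod_dividef atLeast0LessThan)
  qed
  ultimately show ?thesis
    using Lim_transform_eventually by fastforce
qed

section \<open>Adding vertices that every new edge meets once\<close>

definition extend_edges :: "nat \<Rightarrow> 'a hypergraph \<Rightarrow> 'a set \<Rightarrow> 'a hypergraph" where
  "extend_edges k H B =
     (verts H \<union> B,
      edges H \<union> (\<lambda>(b, T). insert b T) ` (B \<times> {T. T \<subseteq> verts H \<and> card T = k - 1}))"

lemma uniform_extend_edges:
  assumes "uniform_hypergraph k H" and "finite B" and "verts H \<inter> B = {}" and "0 < k"
  shows "uniform_hypergraph k (extend_edges k H B)"
proof -
  have "card (insert b T) = k" if "b \<in> B" "T \<subseteq> verts H" "card T = k - 1" for b T
  proof -
    have "finite T" "b \<notin> T"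
      using that assms finite_subset unfolding uniform_hypergraph_def by auto
    then show ?thesis
      using that assms(4) by simp
  qed
  then show ?thesis
    using assms unfolding uniform_hypergraph_def extend_edges_def by auto
qed

text \<open>Since \<open>B\<close> avoids the old vertices, \<open>b\<close> is the only vertex of
  \<open>insert b T\<close> in \<open>B\<close>. So the pair can be recovered from its edge, and no
  new edge is an old one.\<close>

lemma card_edges_extend_edges:
  assumes "uniform_hypergraph k H" and "finite B" and "verts H \<inter> B = {}"
  shows "card (edges (extend_edges k H B))
    = card (edges H) + card B * (card (verts H) choose (k - 1))"
proof -
  let ?P = "B \<times> {T. T \<subseteq> verts H \<and> card T = k - 1}"
  have fin: "finite (verts H)"
    using assms(1) unfolding uniform_hypergraph_def by simp
  have "inj_on (\<lambda>(b, T). insert b T) ?P"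
  proof (rule inj_onI, clarify)
    fix b T b' T'
    assume *: "b \<in> B" "b' \<in> B" "T \<subseteq> verts H" "T' \<subseteq> verts H" "insert b T = insert b' T'"
    have "b = b'"
      using * assms(3) by blast
    moreover have "T = insert b T - {b}" "T' = insert b' T' - {b'}"
      using * assms(3) by auto
    ultimately show "b = b' \<and> T = T'"
      using *(5) by metis
  qed
  then have "card ((\<lambda>(b, T). insert b T) ` ?P) = card B * (card (verts H) choose (k - 1))"
    using n_subsets[OF fin, of "k - 1"] by (simp add: card_image card_cartesian_product)
  moreover have "edges H \<inter> (\<lambda>(b, T). insert b T) ` ?P = {}"
    using assms(1,3) unfolding uniform_hypergraph_def by blast
  moreover have "finite ?P"
    using fin assms(2) by simp
  ultimately show ?thesis
    using finite_edges[OF assms(1)] unfolding extend_edges_def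
    by (simp add: card_Un_disjoint)
qed

lemma turan_number_extend:
  assumes "edges F \<noteq> {}" and "0 < k"
    and ext: "\<And>H B. \<lbrakk>uniform_hypergraph k H; hypergraph_free F H; finite B; verts H \<inter> B = {}\<rbrakk>
      \<Longrightarrow> hypergraph_free G (extend_edges k H B :: nat hypergraph)"
  shows "turan_number k p F + q * (p choose (k - 1)) \<le> turan_number k (p + q) G"
proof -
  obtain H :: "nat hypergraph" where H: "uniform_hypergraph k H" "card (verts H) = p"
    "hypergraph_free F H" "card (edges H) = turan_number k p F"
    using turan_number_attained[OF assms(1)] .
  have fin: "finite (verts H)"
    using H(1) unfolding uniform_hypergraph_def by simp
  \<comment> \<open>Hosts live on the natural numbers, so a finite host leaves room for
    \<open>q\<close> new vertices.\<close>
  then have "infinite (- verts H)"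
    by (simp add: Compl_eq_Diff_UNIV)
  then obtain B where B: "finite B" "card B = q" "B \<subseteq> - verts H"
    using infinite_arbitrarily_large by blast
  then have disj: "verts H \<inter> B = {}"
    by blast
  have "card (verts (extend_edges k H B)) = p + q"
    using fin B disj H(2) by (simp add: extend_edges_def card_Un_disjoint)
  moreover have "card (edges (extend_edges k H B)) = turan_number k p F + q * (p choose (k - 1))"
    using card_edges_extend_edges[OF H(1) B(1) disj] H B by simp
  ultimately show ?thesis
    using card_edges_le_turan_number[OF uniform_extend_edges[OF H(1) B(1) disj assms(2)]
        ext[OF H(1,3) B(1) disj]] by simp
qed

section \<open>From Turan numbers to a strict inequality of densities\<close>

text \<open>The combinatorial input \<open>ext\<close> is turned into an inequality of limits. The
  condition at \<open>l\<close> makes the density of \<open>F\<close> smaller than 1; for density 1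
  the derivative at 0 would vanish.\<close>

lemma turan_density_less:
  assumes "edges F \<noteq> {}" and "edges G \<noteq> {}" and "0 < k"
    and ext: "\<And>H B. \<lbrakk>uniform_hypergraph k H; hypergraph_free F H; finite B; verts H \<inter> B = {}\<rbrakk>
      \<Longrightarrow> hypergraph_free G (extend_edges k H B :: nat hypergraph)"
    and l: "k \<le> l" "turan_number k l F < l choose k"
  shows "turan_density k F < turan_density k G"
proof -
  define a where "a = turan_density k F"
  have "a \<le> real (turan_number k l F) / real (l choose k)"
    unfolding a_def by (rule turan_density_limit(2)[OF assms(1) l(1)])
  also have "\<dots> < 1"
    using l by simp
  finally have "a < 1" .
  \<comment> \<open>Clearing the denominator in \<open>a < (a + k * x) / (1 + x) ^ k\<close> leaves
    the claim that this function exceeds \<open>- a\<close>. It equals \<open>- a\<close> at 0 and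
    has positive slope there, so the claim holds for small positive \<open>x\<close>.\<close>
  have "((\<lambda>x. real k * x - a * (1 + x) ^ k) has_real_derivative (real k - a * real k)) (at 0)"
    by (auto intro!: derivative_eq_intros)
  moreover have "0 < real k - a * real k"
    using \<open>a < 1\<close> assms(3) by simp
  ultimately have "\<exists>d>0. \<forall>h>0. h < d \<longrightarrow> - a < real k * h - a * (1 + h) ^ k"
    using DERIV_pos_inc_right[of "\<lambda>x. real k * x - a * (1 + x) ^ k" _ 0] by fastforce
  then obtain d where d: "0 < d"
    "\<And>x. 0 < x \<Longrightarrow> x < d \<Longrightarrow> - a < real k * x - a * (1 + x) ^ k"
    by blast
  \<comment> \<open>With \<open>x\<close> the reciprocal of an integer \<open>M\<close>, both
    \<open>p = M * q\<close> and \<open>q = x * p\<close> hold exactly, without rounding.\<close>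
  obtain M :: nat where M: "0 < M" "1 / real M < d"
    using d(1) real_arch_inverse[of d] by (auto simp: inverse_eq_divide)
  define x where "x = 1 / real M"
  have "0 < x"
    using M by (simp add: x_def)
  have gain: "a * (1 + x) ^ k < a + real k * x"
    using d(2)[of x] \<open>0 < x\<close> M(2) by (simp add: x_def)
  let ?c = "\<lambda>i n. real (n choose i) / real n ^ i"
  have c: "filterlim g sequentially sequentially \<Longrightarrow> (\<lambda>q. ?c i (g q)) \<longlonglongrightarrow> 1 / fact i" for i g
    by (rule filterlim_compose[OF binomial_over_power_tendsto])
  have seq: "filterlim (\<lambda>q. M * q) sequentially sequentially"
    "filterlim (\<lambda>q. M * q + q) sequentially sequentially"
    using M(1) by (auto intro!: filterlim_subseq strict_monoI add_strict_mono)
  \<comment> \<open>For \<open>p = M * q\<close> this is \<open>(a * (p choose k) + q * (p choose (k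
    - 1))) / (p + q choose k)\<close> with numerator and denominator divided by
    \<open>p ^ k\<close>. As \<open>p + q = (1 + x) * p\<close>, only convergent quotients
    remain.\<close>
  let ?lower = "\<lambda>q. (a * ?c k (M * q) + x * ?c (k - 1) (M * q)) / ((1 + x) ^ k * ?c k (M * q + q))"
  have "?lower \<longlonglongrightarrow> (a * (1 / fact k) + x * (1 / fact (k - 1))) / ((1 + x) ^ k * (1 / fact k))"
    using \<open>0 < x\<close> by (intro tendsto_intros c seq) auto
  \<comment> \<open>\<open>fact k = k * fact (k - 1)\<close> is the source of the factor
    \<open>k\<close> in front of \<open>x\<close>.\<close>
  also have "(a * (1 / fact k) + x * (1 / fact (k - 1))) / ((1 + x) ^ k * (1 / fact k))
      = (a + real k * x) / (1 + x) ^ k"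
    using assms(3) \<open>0 < x\<close> by (simp add: fact_reduce field_simps)
  finally have low: "?lower \<longlonglongrightarrow> (a + real k * x) / (1 + x) ^ k" .
  have up: "(\<lambda>q. real (turan_number k (M * q + q) G) / real (M * q + q choose k))
      \<longlonglongrightarrow> turan_density k G"
    by (rule filterlim_compose[OF turan_density_limit(1)[OF assms(2)] seq(2)])
  have "?lower q \<le> real (turan_number k (M * q + q) G) / real (M * q + q choose k)"
    if "k \<le> q" for q
  proof -
    let ?p = "M * q"
    have "0 < q"
      using that assms(3) by simp
    have "k \<le> ?p"
      using that M(1) by (simp add: le_trans[of k q])
    then have "a \<le> real (turan_number k ?p F) / real (?p choose k)"
      unfolding a_def by (rule turan_density_limit(2)[OF assms(1)])
    then have "a * real (?p choose k) \<le> real (turan_number k ?p F)"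
      using \<open>k \<le> ?p\<close> by (simp add: field_simps)
    then have num: "a * real (?p choose k) + real q * real (?p choose (k - 1))
        \<le> real (turan_number k (?p + q) G)"
      using turan_number_extend[OF assms(1,3) ext, of ?p q]
      by (smt (verit) of_nat_add of_nat_le_iff of_nat_mult)
    have pow: "real ?p ^ k = real ?p * real ?p ^ (k - 1)"
      using assms(3) by (cases k) auto
    have xp: "x * real ?p = real q"
      using M(1) by (simp add: x_def)
    have scale: "(1 + x) ^ k * real ?p ^ k = real (?p + q) ^ k"
      using xp by (simp add: power_mult_distrib[symmetric] distrib_right del: of_nat_mult)
    have pos: "0 < real ?p"
      using M(1) \<open>0 < q\<close> by simp
    have "?lower q = (a * real (?p choose k) + real q * real (?p choose (k - 1)))
        / real (?p + q choose k)"
    proof -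
      have "a * ?c k ?p + x * ?c (k - 1) ?p
          = (a * real (?p choose k) + real q * real (?p choose (k - 1))) / real ?p ^ k"
        unfolding pow xp[symmetric] using pos by (simp add: field_simps del: of_nat_mult)
      moreover have "(1 + x) ^ k * ?c k (?p + q) = real (?p + q choose k) / real ?p ^ k"
        unfolding scale[symmetric] using pos \<open>0 < x\<close> by (simp add: field_simps)
      moreover have "real ?p ^ k \<noteq> 0"
        using M(1) \<open>0 < q\<close> by simp
      ultimately show ?thesis
        by (simp only:) (simp del: of_nat_mult)
    qed
    then show ?thesis
      using num by (simp add: divide_right_mono)
  qed
  \<comment> \<open>Only a weak inequality survives the limit; strictness comes from
    \<open>a\<close> being below the limit of the lower bounds.\<close>
  then have "(a + real k * x) / (1 + x) ^ k \<le> turan_density k G"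
    by (intro LIMSEQ_le[OF low up]) blast
  moreover have "a < (a + real k * x) / (1 + x) ^ k"
    using gain \<open>0 < x\<close> by (simp add: field_simps)
  ultimately show ?thesis
    unfolding a_def by simp
qed

section \<open>Cliques with few missing edges\<close>

text \<open>\<open>m = 0\<close> and \<open>m = 1\<close> capture both kinds of clique, without
  fixing which edge is missing. \<open>R\<close> only covers the missing edges and may contain other
  sets; its finiteness is demanded because an infinite set has \<open>card\<close> 0.\<close>

definition near_clique :: "nat \<Rightarrow> nat \<Rightarrow> nat \<Rightarrow> 'a hypergraph \<Rightarrow> bool" where
  "near_clique k l m H \<longleftrightarrow>
     (\<exists>S R. S \<subseteq> verts H \<and> card S = l \<and> finite R \<and> card R \<le> m \<and>
        (\<forall>e. e \<subseteq> S \<and> card e = k \<and> e \<notin> R \<longrightarrow> e \<in> edges H))"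

text \<open>No edge has two vertices in \<open>B\<close>. Two vertices of \<open>S\<close> in
  \<open>B\<close> would thus force \<open>(l - 1) choose (k - 2)\<close> sets into
  \<open>R\<close>, too many. So deleting one vertex moves \<open>S\<close> into the old part, with
  the same \<open>R\<close>.\<close>

lemma near_clique_extend_edgesD:
  assumes "uniform_hypergraph k H" and "finite B" and "verts H \<inter> B = {}"
    and k: "2 \<le> k" and l: "0 < l" and m: "m < (l - 1) choose (k - 2)"
    and nc: "near_clique k (l + 1) m (extend_edges k H B)"
  shows "near_clique k l m H"
proof -
  obtain S R where S: "S \<subseteq> verts H \<union> B" "card S = l + 1" and R: "finite R" "card R \<le> m"
    and e: "\<And>e. \<lbrakk>e \<subseteq> S; card e = k; e \<notin> R\<rbrakk> \<Longrightarrow> e \<in> edges (extend_edges k H B)"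
    using nc unfolding near_clique_def by (auto simp: extend_edges_def)
  have edge: "e \<subseteq> verts H" if "e \<in> edges H" for e
    using assms(1) that unfolding uniform_hypergraph_def by auto
  have fin: "finite S"
    using S(2) card.infinite by fastforce
  have unique: "b = b'" if b: "b \<in> S \<inter> B" "b' \<in> S \<inter> B" for b b'
  proof (rule ccontr)
    assume "b \<noteq> b'"
    let ?T = "{T. T \<subseteq> S - {b, b'} \<and> card T = k - 2}"
    have "card (S - {b, b'}) = l - 1"
      using fin b \<open>b \<noteq> b'\<close> S(2) by (simp add: card_Diff_subset)
    then have card: "card ?T = (l - 1) choose (k - 2)"
      using n_subsets[of "S - {b, b'}" "k - 2"] fin by simp
    have "insert b (insert b' T) \<in> R" if "T \<in> ?T" for T
    proof (rule ccontr)
      assume "insert b (insert b' T) \<notin> R"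
      moreover have "finite T" "b \<notin> T" "b' \<notin> T"
        using that fin finite_subset by auto
      then have "card (insert b (insert b' T)) = k"
        using that k \<open>b \<noteq> b'\<close> by simp
      moreover have "insert b (insert b' T) \<subseteq> S"
        using b that by blast
      ultimately have "insert b (insert b' T) \<in> edges (extend_edges k H B)"
        by (intro e)
      then consider "insert b (insert b' T) \<in> edges H"
        | c U where "insert b (insert b' T) = insert c U" "U \<subseteq> verts H"
        by (auto simp: extend_edges_def)
      then show False
      proof cases
        case 1
        then show False
          using edge b assms(3) by blast
      next
        case 2
        then have "b = c" "b' = c"
          using b assms(3) by blast+
        then show False
          using \<open>b \<noteq> b'\<close> by simp
      qed
    qed
    moreover have "inj_on (\<lambda>T. insert b (insert b' T)) ?T"
      by (rule inj_onI) blast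
    ultimately have "card ?T \<le> card R"
      using card_inj_on_le[of "\<lambda>T. insert b (insert b' T)" ?T R] R(1) by blast
    then show False
      using card R(2) m by simp
  qed
  \<comment> \<open>The deleted vertex is the one in \<open>B\<close> if there is one, otherwise any
    vertex, so that \<open>l\<close> old vertices remain.\<close>
  obtain v where v: "v \<in> S" "S - {v} \<subseteq> verts H"
  proof (cases "S \<inter> B = {}")
    case True
    have "S \<noteq> {}"
      using S(2) by auto
    then show thesis
      using that True S(1) by blast
  next
    case False
    then show thesis
      using that unique S(1) by blast
  qed
  have "card (S - {v}) = l"
    using v fin S(2) by simp
  moreover have "e \<in> edges H" if "e \<subseteq> S - {v}" "card e = k" "e \<notin> R" for e
  proof -
    have "e \<in> edges (extend_edges k H B)"
      using \<open>\<And>e. \<lbrakk>e \<subseteq> S; card e = k; e \<notin> R\<rbrakk> \<Longrightarrow> e \<in> edges (extend_edges k H B)\<close> that by blast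
    \<comment> \<open>Each added edge contains a vertex of \<open>B\<close>, so an edge that avoids
      \<open>B\<close> was already present.\<close>
    moreover have "e \<inter> B = {}"
      using that v(2) assms(3) by blast
    ultimately show ?thesis
      by (auto simp: extend_edges_def)
  qed
  ultimately show ?thesis
    unfolding near_clique_def using v(2) R by blast
qed

text \<open>A host of order \<open>l\<close> with all \<open>k\<close>-sets as edges would itself be
  a near clique with nothing missing. This supplies the ratio below 1.\<close>

lemma turan_number_less_binomial:
  assumes free: "\<And>H :: nat hypergraph. hypergraph_free F H \<longleftrightarrow> \<not> near_clique k l m H"
    and "edges F \<noteq> {}"
  shows "turan_number k l F < l choose k"
proof -
  obtain H :: "nat hypergraph" where H: "uniform_hypergraph k H" "card (verts H) = l"
    "hypergraph_free F H" "card (edges H) = turan_number k l F"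
    using turan_number_attained[OF assms(2)] .
  let ?K = "{e. e \<subseteq> verts H \<and> card e = k}"
  have fin: "finite (verts H)" and sub: "edges H \<subseteq> ?K"
    using H(1) unfolding uniform_hypergraph_def by auto
  have "edges H \<noteq> ?K"
  proof
    assume "edges H = ?K"
    then have "near_clique k l m H"
      unfolding near_clique_def using H(2)
      by (intro exI[of _ "verts H"] exI[of _ "{}"]) auto
    then show False
      using free H(3) by blast
  qed
  then have "card (edges H) < card ?K"
    using sub fin by (intro psubset_card_mono) auto
  then show ?thesis
    using n_subsets[OF fin, of k] H(2,4) by simp
qed

lemma turan_density_less_near_clique:
  assumes F: "\<And>H :: nat hypergraph. hypergraph_free F H \<longleftrightarrow> \<not> near_clique k l m H"
    and G: "\<And>H :: nat hypergraph. hypergraph_free G H \<longleftrightarrow> \<not> near_clique k (l + 1) m H"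
    and "edges F \<noteq> {}" and "edges G \<noteq> {}"
    and "2 \<le> k" and "k \<le> l" and "m < (l - 1) choose (k - 2)"
  shows "turan_density k F < turan_density k G"
proof (rule turan_density_less)
  show "hypergraph_free G (extend_edges k H B)"
    if "uniform_hypergraph k H" "hypergraph_free F H" "finite B" "verts H \<inter> B = {}"
    for H :: "nat hypergraph" and B
    using near_clique_extend_edgesD[OF that(1,3,4) assms(5) _ assms(7)] that(2) F G assms(5,6)
    by auto
  show "turan_number k l F < l choose k"
    by (rule turan_number_less_binomial[OF F assms(3)])
qed (use assms in auto)

section \<open>Forbidden cliques as near cliques\<close>

text \<open>The image of an embedding is the copy. The hypothesis keeps image edges inside the image
  vertices, as \<open>subhypergraph\<close> demands.\<close>

lemma hypergraph_free_iff_embedding: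
  assumes "\<And>e. e \<in> edges F \<Longrightarrow> e \<subseteq> verts F"
  shows "hypergraph_free F H \<longleftrightarrow>
    \<not> (\<exists>f. inj_on f (verts F) \<and> f ` verts F \<subseteq> verts H \<and> (\<forall>e\<in>edges F. f ` e \<in> edges H))"
    (is "_ \<longleftrightarrow> \<not> ?emb")
proof -
  have "(\<exists>S. subhypergraph S H \<and> hypergraph_iso F S) \<longleftrightarrow> ?emb"
  proof
    assume "\<exists>S. subhypergraph S H \<and> hypergraph_iso F S"
    then obtain S f where S: "subhypergraph S H" and f: "bij_betw f (verts F) (verts S)"
      "edges S = (\<lambda>e. f ` e) ` edges F"
      unfolding hypergraph_iso_def by blast
    have "inj_on f (verts F)" "f ` verts F \<subseteq> verts H" "\<forall>e\<in>edges F. f ` e \<in> edges H"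
      using S f unfolding subhypergraph_def bij_betw_def by auto
    then show ?emb
      by blast
  next
    assume ?emb
    then obtain f where f: "inj_on f (verts F)" "f ` verts F \<subseteq> verts H"
      "\<forall>e\<in>edges F. f ` e \<in> edges H"
      by blast
    let ?S = "(f ` verts F, (\<lambda>e. f ` e) ` edges F)"
    have "\<forall>e\<in>edges F. f ` e \<subseteq> f ` verts F"
      using assms by blast
    then have "subhypergraph ?S H"
      using f unfolding subhypergraph_def fst_conv snd_conv by blast
    moreover have "hypergraph_iso F ?S"
      using f(1) unfolding hypergraph_iso_def bij_betw_def by auto
    ultimately show "\<exists>S. subhypergraph S H \<and> hypergraph_iso F S"
      by blast
  qed
  then show ?thesis
    unfolding hypergraph_free_def by simp
qed

text \<open>\<open>complete_hypergraph_minus\<close> always removes \<open>{..<k}\<close>, so an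
  enumeration of a near clique has to put its missing edge on the first \<open>k\<close>
  indices.\<close>

lemma ex_bij_betw_initial_segments:
  assumes "finite S" and "T \<subseteq> S"
  obtains f where "bij_betw f {..<card S} S" "f ` {..<card T} = T"
proof -
  have fin: "finite T"
    using assms finite_subset by blast
  obtain g where g: "bij_betw g {..<card T} T"
    using ex_bij_betw_nat_finite[OF fin] by (auto simp: atLeast0LessThan)
  have le: "card T \<le> card S"
    using assms card_mono by blast
  have "card {card T..<card S} = card (S - T)"
    using assms fin by (simp add: card_Diff_subset)
  then obtain h where h: "bij_betw h {card T..<card S} (S - T)"
    using finite_same_card_bij[of "{card T..<card S}" "S - T"] assms(1) by auto
  let ?f = "\<lambda>i. if i \<in> {..<card T} then g i else h i"
  have "bij_betw ?f ({..<card T} \<union> {card T..<card S}) (T \<union> (S - T))"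
    by (rule bij_betw_disjoint_Un[OF g h]) auto
  moreover have "{..<card T} \<union> {card T..<card S} = {..<card S}" "T \<union> (S - T) = S"
    using le assms(2) by auto
  moreover have "?f ` {..<card T} = T"
    using g by (simp add: bij_betw_def)
  ultimately show thesis
    using that[of ?f] by simp
qed

lemma hypergraph_free_complete_iff:
  assumes "0 < l"
  shows "hypergraph_free (complete_hypergraph k l) H \<longleftrightarrow> \<not> near_clique k l 0 H"
proof -
  have "(\<exists>f. inj_on f {..<l} \<and> f ` {..<l} \<subseteq> verts H \<and>
      (\<forall>e\<in>{e. e \<subseteq> {..<l} \<and> card e = k}. f ` e \<in> edges H)) \<longleftrightarrow> near_clique k l 0 H"
    (is "?emb \<longleftrightarrow> _")
  proof
    assume ?emb
    then obtain f where f: "inj_on f {..<l}" "f ` {..<l} \<subseteq> verts H"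
      "\<And>e. \<lbrakk>e \<subseteq> {..<l}; card e = k\<rbrakk> \<Longrightarrow> f ` e \<in> edges H"
      by blast
    have "e \<in> edges H" if e: "e \<subseteq> f ` {..<l}" "card e = k" for e
    proof -
      obtain d where d: "d \<subseteq> {..<l}" "e = f ` d"
        using e(1) by (meson subset_imageE)
      then have "card d = k"
        using e(2) f(1) by (metis card_image inj_on_subset)
      then show ?thesis
        using f(3) d by blast
    qed
    then show "near_clique k l 0 H"
      unfolding near_clique_def using f(1,2)
      by (intro exI[of _ "f ` {..<l}"] exI[of _ "{}"]) (auto simp: card_image)
  next
    assume "near_clique k l 0 H"
    then obtain S where S: "S \<subseteq> verts H" "card S = l"
      and e: "\<And>e. \<lbrakk>e \<subseteq> S; card e = k\<rbrakk> \<Longrightarrow> e \<in> edges H"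
      unfolding near_clique_def by auto
    \<comment> \<open>\<open>0 < l\<close> excludes an infinite \<open>S\<close>, whose
      \<open>card\<close> would be 0.\<close>
    have "finite S"
      using S(2) assms card.infinite by fastforce
    then obtain f where f: "bij_betw f {..<l} S"
      using ex_bij_betw_nat_finite S(2) by (metis atLeast0LessThan)
    have "f ` e \<in> edges H" if "e \<subseteq> {..<l}" "card e = k" for e
    proof (rule e)
      show "f ` e \<subseteq> S"
        using f that(1) unfolding bij_betw_def by blast
      show "card (f ` e) = k"
        using f that unfolding bij_betw_def by (metis card_image inj_on_subset)
    qed
    then show ?emb
      using f S(1) unfolding bij_betw_def by blast
  qed
  moreover have "e \<subseteq> verts (complete_hypergraph k l)" if "e \<in> edges (complete_hypergraph k l)" for e
    using that by (auto simp: complete_hypergraph_def)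
  then have "hypergraph_free (complete_hypergraph k l) H \<longleftrightarrow> \<not> ?emb"
    using hypergraph_free_iff_embedding[of "complete_hypergraph k l" H]
    unfolding complete_hypergraph_def fst_conv snd_conv by blast
  ultimately show ?thesis
    by blast
qed

text \<open>In a copy, the image of \<open>{..<k}\<close> is the only set that can be missing.
  Conversely, the vertices of a near clique are relabelled so that its missing edge becomes
  \<open>{..<k}\<close>.\<close>

lemma hypergraph_free_complete_minus_iff:
  assumes "0 < k" and "k \<le> l"
  shows "hypergraph_free (complete_hypergraph_minus k l) H \<longleftrightarrow> \<not> near_clique k l 1 H"
proof -
  have "(\<exists>f. inj_on f {..<l} \<and> f ` {..<l} \<subseteq> verts H \<and>
      (\<forall>e\<in>{e. e \<subseteq> {..<l} \<and> card e = k} - {{..<k}}. f ` e \<in> edges H)) \<longleftrightarrow> near_clique k l 1 H"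
    (is "?emb \<longleftrightarrow> _")
  proof
    assume ?emb
    then obtain f where f: "inj_on f {..<l}" "f ` {..<l} \<subseteq> verts H"
      "\<And>e. \<lbrakk>e \<subseteq> {..<l}; card e = k; e \<noteq> {..<k}\<rbrakk> \<Longrightarrow> f ` e \<in> edges H"
      by blast
    have "e \<in> edges H" if e: "e \<subseteq> f ` {..<l}" "card e = k" "e \<noteq> f ` {..<k}" for e
    proof -
      obtain d where d: "d \<subseteq> {..<l}" "e = f ` d"
        using e(1) by (meson subset_imageE)
      then have "card d = k"
        using e(2) f(1) by (metis card_image inj_on_subset)
      then show ?thesis
        using f(3) d e(3) by blast
    qed
    then show "near_clique k l 1 H"
      unfolding near_clique_def using f(1,2)
      by (intro exI[of _ "f ` {..<l}"] exI[of _ "{f ` {..<k}}"]) (auto simp: card_image)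
  next
    assume "near_clique k l 1 H"
    then obtain S R where S: "S \<subseteq> verts H" "card S = l" and R: "finite R" "card R \<le> 1"
      and e: "\<And>e. \<lbrakk>e \<subseteq> S; card e = k; e \<notin> R\<rbrakk> \<Longrightarrow> e \<in> edges H"
      unfolding near_clique_def by auto
    have fin: "finite S"
      using S(2) assms card.infinite by fastforce
    \<comment> \<open>\<open>T\<close> is the \<open>k\<close>-subset of \<open>S\<close> in
      \<open>R\<close> if there is one, otherwise any \<open>k\<close>-subset: copies need not be
      induced, so \<open>T\<close> may well be an edge of \<open>H\<close>.\<close>
    obtain T where T: "T \<subseteq> S" "card T = k" "\<And>e. \<lbrakk>e \<subseteq> S; card e = k; e \<noteq> T\<rbrakk> \<Longrightarrow> e \<notin> R"
    proof (cases "\<exists>T\<in>R. T \<subseteq> S \<and> card T = k")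
      case True
      then show thesis
        using that card_le_Suc0_iff_eq[OF R(1)] R(2) by (metis One_nat_def)
    next
      case False
      moreover obtain T where "T \<subseteq> S" "card T = k"
        using obtain_subset_with_card_n[of k S] assms(2) S(2) by blast
      ultimately show thesis
        using that by blast
    qed
    obtain f where f: "bij_betw f {..<l} S" "f ` {..<k} = T"
      using ex_bij_betw_initial_segments[OF fin T(1)] S(2) T(2) by blast
    have "f ` e \<in> edges H" if d: "e \<subseteq> {..<l}" "card e = k" "e \<noteq> {..<k}" for e
    proof -
      have inj: "inj_on f {..<l}"
        using f(1) by (simp add: bij_betw_def)
      have sub: "f ` e \<subseteq> S"
        using f(1) d(1) unfolding bij_betw_def by blast
      have "f ` e \<noteq> T"
        using f(2) inj_on_image_eq_iff[OF inj d(1), of "{..<k}"] d(3) assms(2) by auto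
      moreover have "card (f ` e) = k"
        using inj d by (metis card_image inj_on_subset)
      ultimately show ?thesis
        using e T(3) sub by blast
    qed
    then show ?emb
      using f(1) S(1) unfolding bij_betw_def by blast
  qed
  moreover have "e \<subseteq> verts (complete_hypergraph_minus k l)" if "e \<in> edges (complete_hypergraph_minus k l)" for e
    using that by (auto simp: complete_hypergraph_minus_def complete_hypergraph_def)
  then have "hypergraph_free (complete_hypergraph_minus k l) H \<longleftrightarrow> \<not> ?emb"
    using hypergraph_free_iff_embedding[of "complete_hypergraph_minus k l" H]
    unfolding complete_hypergraph_minus_def complete_hypergraph_def fst_conv snd_conv by blast
  ultimately show ?thesis
    by blast
qed

lemma edges_complete_nonempty:
  assumes "k \<le> l"
  shows "edges (complete_hypergraph k l) \<noteq> {}"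
proof -
  have "{..<k} \<in> edges (complete_hypergraph k l)"
    using assms by (auto simp: complete_hypergraph_def)
  then show ?thesis
    by blast
qed

text \<open>For \<open>k = l\<close> the removed edge is the only one; one more vertex leaves room
  for a shifted \<open>k\<close>-set.\<close>

lemma edges_complete_minus_nonempty:
  assumes "0 < k" and "k < l"
  shows "edges (complete_hypergraph_minus k l) \<noteq> {}"
proof -
  have "{1..k} \<in> edges (complete_hypergraph_minus k l)"
  proof -
    have "0 \<in> {..<k}" "0 \<notin> {1..k}"
      using assms(1) by auto
    then have "{1..k} \<noteq> {..<k}"
      by metis
    moreover have "{1..k} \<subseteq> {..<l}"
      using assms(2) by auto
    ultimately show ?thesis
      by (simp add: complete_hypergraph_minus_def complete_hypergraph_def)
  qed
  then show ?thesis
    by blast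
qed

theorem theorem1p1:
  fixes k l :: nat
  assumes "3 \<le> k" and "k < l"
  shows "turan_density k (complete_hypergraph k l)
           < turan_density k (complete_hypergraph k (l + 1))
       \<and> turan_density k (complete_hypergraph_minus k l)
           < turan_density k (complete_hypergraph_minus k (l + 1))"
proof
  \<comment> \<open>Pascal's rule splits the coefficient into two positive summands, so it exceeds
    1, as one missing edge requires. By \<open>3 \<le> k\<close> the subtraction
    \<open>k - 3\<close> does not truncate.\<close>
  have "l - 1 = Suc (l - 2)" "k - 2 = Suc (k - 3)"
    using assms by simp_all
  then have "(l - 1) choose (k - 2) = (l - 2 choose (k - 3)) + (l - 2 choose Suc (k - 3))"
    by (simp only: binomial_Suc_Suc)
  moreover have "0 < l - 2 choose (k - 3)" "0 < l - 2 choose Suc (k - 3)"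
    using assms by simp_all
  ultimately have big: "1 < (l - 1) choose (k - 2)"
    by linarith
  show "turan_density k (complete_hypergraph k l) < turan_density k (complete_hypergraph k (l + 1))"
    using assms big
    by (intro turan_density_less_near_clique[where m = 0 and l = l]
        hypergraph_free_complete_iff edges_complete_nonempty) auto
  show "turan_density k (complete_hypergraph_minus k l)
      < turan_density k (complete_hypergraph_minus k (l + 1))"
    using assms big
    by (intro turan_density_less_near_clique[where m = 1 and l = l]
        hypergraph_free_complete_minus_iff edges_complete_minus_nonempty) auto
qed

end
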